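(* Let $\sigma$ be a motorized parallel chip-firing game on a graph $G$ with set of motors $M\subseteq V(G)$. Suppose that every motor's firing sequence $(F^{\sigma}_t(m))_{t\in\mathbb N}$, $m\in M$, is possible, and that the firing sequences of all motors have the same activity. Then there exists an ordinary parallel chip-firing game $\sigma'$ on a graph $H\supseteq G$ such that (i) $F^{\sigma'}_t(u)=F^{\sigma}_t(u)$ for all $t\in\mathbb N$ and all $u\in V(G)$; (ii) $d_H(v)=d_G(v)$ for all $v\in V(G)\setminus M$; and (iii) the subgraph of $H$ induced by $V(G)$ is $G$ (that is, $H$ contains no edges between vertices of $G$ that are not also in $G$).
   Context: All graphs are finite, undirected, simple and connected; $N_G(v)$ is the set of neighbors of $v$ in $G$, $d_G(v)=\#N_G(v)$, and $\mathbb{N}=\{0,1,2,\dots\}$. $H\supseteq G$ means that $G$ is a subgraph of $H$. A parallel chip-firing game $\sigma$ on a graph $G$ is a sequence $(\sigma_t)_{t\in\mathbb N}$ of positions, where $\sigma_t(v)$ is the number of chips on $v$ at time $t$, together with firing indicators $F^\sigma_t(v)\in\{0,1\}$, such that for all $v$ and $t$ $$\sigma_{t+1}(v)=\sigma_t(v)+\sum_{w\in N_G(v)}F^\sigma_t(w)-F^\sigma_t(v)\,d_G(v).$$ In an ordinary game, all chip counts are natural numbers and $F^\sigma_t(v)=1$ if $\sigma_t(v)\ge d_G(v)$, $F^\sigma_t(v)=0$ if $\sigma_t(v)\le d_G(v)-1$, for all $v\in V(G)$. In a motorized game there is a non-empty set $M\subseteq V(G)$ of motors: for each motor $m\in M$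 the firing sequence $(F^\sigma_t(m))_{t\in\mathbb N}$ is a predetermined $0/1$ sequence, independent of $\sigma_t(m)$ (and $\sigma_t(m)$ is an integer that may be negative), while each vertex $v\notin M$ has natural-number chip counts and follows the ordinary rule for $F^\sigma_t(v)$. A sequence $(f_t)_{t\in\mathbb N}$ in $\{0,1\}$ is possible if there exist a graph $A$, an ordinary game $\rho$ on $A$ and a vertex $u\in V(A)$ with $F^{\rho}_t(u)=f_t$ for all $t\in\mathbb N$. Every ordinary game is eventually periodic, so a possible sequence is eventually periodic; its activity is its firing frequency, $\lim_{n\to\infty}\frac1n\sum_{t=0}^{n-1}f_t$. *)

theory Defs
  imports
    Complex_Main
    "HOL-Library.Infinite_Typeclass"
    "Graph_Theory.Digraph_Component"
    "Graph_Theory.Pair_Digraph"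
begin

text \<open>
  An undirected simple graph is a symmetric, loop-free finite digraph whose arcs are pairs: an
  edge between u and v is the pair of arcs (u,v), (v,u). Connectedness includes that there is
  at least one vertex.
\<close>

definition connected_graph :: "'a pair_pre_digraph \<Rightarrow> bool" where
  "connected_graph G \<longleftrightarrow> pair_graph G \<and> Digraph_Component.connected (with_proj G)"

definition nbrs :: "'a pair_pre_digraph \<Rightarrow> 'a \<Rightarrow> 'a set" where
  "nbrs G v = {w. (v, w) \<in> parcs G}"

definition deg :: "'a pair_pre_digraph \<Rightarrow> 'a \<Rightarrow> nat" where
  "deg G v = card (nbrs G v)"

text \<open>
  Time is the first argument. Only the values at the vertices of the graph matter. Chip counts
  are integers because those of motors may be negative.
\<close>

record 'a chip_game =
  chips :: "nat \<Rightarrow> 'a \<Rightarrow> int"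
  fires :: "nat \<Rightarrow> 'a \<Rightarrow> nat"

definition chip_firing_game :: "'a pair_pre_digraph \<Rightarrow> 'a chip_game \<Rightarrow> bool" where
  "chip_firing_game G \<sigma> \<longleftrightarrow>
     (\<forall>t. \<forall>v\<in>pverts G.
        fires \<sigma> t v \<in> {0, 1} \<and>
        chips \<sigma> (Suc t) v =
          chips \<sigma> t v + (\<Sum>w\<in>nbrs G v. int (fires \<sigma> t w)) - int (fires \<sigma> t v) * int (deg G v))"

definition ordinary_at :: "'a pair_pre_digraph \<Rightarrow> 'a chip_game \<Rightarrow> 'a \<Rightarrow> bool" where
  "ordinary_at G \<sigma> v \<longleftrightarrow>
     (\<forall>t. 0 \<le> chips \<sigma> t v \<and>
        (chips \<sigma> t v \<ge> int (deg G v) \<longrightarrow> fires \<sigma> t v = 1) \<and>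
        (chips \<sigma> t v \<le> int (deg G v) - 1 \<longrightarrow> fires \<sigma> t v = 0))"

definition ordinary_game :: "'a pair_pre_digraph \<Rightarrow> 'a chip_game \<Rightarrow> bool" where
  "ordinary_game G \<sigma> \<longleftrightarrow> chip_firing_game G \<sigma> \<and> (\<forall>v\<in>pverts G. ordinary_at G \<sigma> v)"

text \<open>
  The predetermined firing sequence of a motor m is \<open>\<lambda>t. fires \<sigma> t m\<close>; it is an arbitrary
  0/1 sequence, unrelated to the chips on m.
\<close>

definition motorized_game :: "'a pair_pre_digraph \<Rightarrow> 'a set \<Rightarrow> 'a chip_game \<Rightarrow> bool" where
  "motorized_game G M \<sigma> \<longleftrightarrow>
     M \<noteq> {} \<and> M \<subseteq> pverts G \<and> chip_firing_game G \<sigma> \<and> (\<forall>v\<in>pverts G - M. ordinary_at G \<sigma> v)"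

text \<open>
  Every finite graph has an isomorphic copy with natural numbers as vertices, so taking A over
  nat loses nothing.
\<close>

definition possible :: "(nat \<Rightarrow> nat) \<Rightarrow> bool" where
  "possible f \<longleftrightarrow>
     (\<exists>(A :: nat pair_pre_digraph) \<rho> u.
        connected_graph A \<and> ordinary_game A \<rho> \<and> u \<in> pverts A \<and> (\<forall>t. fires \<rho> t u = f t))"

text \<open>The limit exists for every eventually periodic f, in particular for every possible f.\<close>

definition activity :: "(nat \<Rightarrow> nat) \<Rightarrow> real" where
  "activity f = lim (\<lambda>n. (1 / real n) * (\<Sum>t<n. real (f t)))"

end

theory Submission
  imports Defs
begin

text \<open>
  The chips on each motor stay bounded. For a motor, the number of firings up to time \<open>n\<close> differs
  from \<open>\<alpha> n\<close> by a bounded amount, \<open>\<alpha>\<close> being the common activity, because possible sequences are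
  eventually periodic. At every other vertex the chip count is bounded, and its deviation from the
  initial count is the Laplacian of the cumulative firing counts, so a maximum principle extends
  the bound to all vertices; and the chips on a motor are again determined by that Laplacian.

  Hence each motor \<open>m\<close> can be simulated by gluing to it, at \<open>u\<close>, many copies of a graph \<open>A\<close> with an
  ordinary game \<open>\<rho>\<close> whose vertex \<open>u\<close> fires as prescribed. With \<open>k\<close> copies, \<open>m\<close> receives
  \<open>k \<rho>\<^sub>t(u) + c\<close> additional chips. The first term reaches \<open>k d\<^sub>A(u)\<close> if \<open>u\<close> fires and falls short of
  it by at least \<open>k\<close> otherwise, so for suitable \<open>c\<close> and large \<open>k\<close> the bounded contribution of \<open>G\<close>
  does not influence whether \<open>m\<close> fires.
\<close>

section \<open>Connected graphs in terms of vertex and arc sets\<close>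

text \<open>The arcs are already symmetric, so passing to the symmetric closure adds nothing. They
  also stay among the vertices, so reachability is plain transitive closure of
  \<open>parcs G\<close>, which allows induction along paths.\<close>

lemma connected_graph_iff:
  "connected_graph G \<longleftrightarrow>
     finite (pverts G) \<and> pverts G \<noteq> {} \<and> parcs G \<subseteq> pverts G \<times> pverts G \<and> sym (parcs G) \<and>
     irrefl (parcs G) \<and> (\<forall>u\<in>pverts G. \<forall>v\<in>pverts G. (u, v) \<in> (parcs G)\<^sup>*)"
    (is "_ \<longleftrightarrow> ?R")
proof
  assume *: "connected_graph G"
  then interpret pair_graph G by (simp add: connected_graph_def)
  have "strongly_connected (with_proj (mk_symmetric (with_proj G)))"
    using * by (simp add: connected_graph_def Digraph_Component.connected_def)
  moreover have "sym (parcs G)"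
    using pair_sym_arcs by (simp add: symmetric_def)
  moreover have "parcs (mk_symmetric (with_proj G)) = parcs G"
    using adj_mk_symmetric_eq pair_sym_arcs by simp
  ultimately have "pverts G \<noteq> {}" "\<forall>u\<in>pverts G. \<forall>v\<in>pverts G. (u, v) \<in> (parcs G)\<^sup>*"
    by (auto simp: strongly_connected_def reachable_def intro!: rtrancl_on_rtranclI[of _ _ "pverts G"])
  moreover have "parcs G \<subseteq> pverts G \<times> pverts G"
    using in_arcsD1 in_arcsD2 by auto
  moreover have "irrefl (parcs G)"
    using no_loops' unfolding irrefl_def by blast
  ultimately show ?R
    using pair_finite_verts \<open>sym (parcs G)\<close> by blast
next
  assume R: ?R
  then have "finite (parcs G)"
    using finite_subset by blast
  with R interpret pair_graph G
    by unfold_locales (auto simp: symmetric_def irrefl_def)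
  have eq: "parcs (mk_symmetric (with_proj G)) = parcs G"
    using adj_mk_symmetric_eq pair_sym_arcs by simp
  have "(u, v) \<in> rtrancl_on (pverts G) (parcs G)" if "u \<in> pverts G" "v \<in> pverts G" for u v
    using R that by (intro rtrancl_consistent_rtrancl_on) auto
  with R eq have "Digraph_Component.connected (with_proj G)"
    by (simp add: Digraph_Component.connected_def strongly_connected_def reachable_def)
  then show "connected_graph G"
    using pair_graph_axioms by (simp add: connected_graph_def)
qed

lemma nbrs_subset_pverts: "connected_graph G \<Longrightarrow> nbrs G v \<subseteq> pverts G"
  by (auto simp: connected_graph_iff nbrs_def)

lemma finite_nbrs: "connected_graph G \<Longrightarrow> finite (nbrs G v)"
  by (rule finite_subset[OF nbrs_subset_pverts]) (auto simp: connected_graph_iff)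

section \<open>Boundedness and eventual periodicity of ordinary games\<close>

lemma nbr_fires_le_deg:
  assumes "connected_graph G" "chip_firing_game G \<sigma>"
  shows "(\<Sum>w\<in>nbrs G v. int (fires \<sigma> t w)) \<le> int (deg G v)"
proof -
  have "int (fires \<sigma> t w) \<le> 1" if "w \<in> nbrs G v" for w
  proof -
    have "w \<in> pverts G"
      using that nbrs_subset_pverts[OF assms(1)] by blast
    then have "fires \<sigma> t w \<in> {0, 1}"
      using assms(2) by (simp add: chip_firing_game_def)
    then show ?thesis by auto
  qed
  then show ?thesis
    using sum_bounded_above[of "nbrs G v" "\<lambda>w. int (fires \<sigma> t w)" 1] by (simp add: deg_def)
qed

text \<open>A firing vertex loses its degree and regains at most that much. A waiting vertex holds
  fewer chips than its degree and also gains at most its degree. The ordinary rule is assumed at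
  \<open>v\<close> alone, so the bound also serves the non-motors of a motorized game.\<close>

lemma ordinary_at_chips_le:
  assumes "connected_graph G" "chip_firing_game G \<sigma>" "v \<in> pverts G" "ordinary_at G \<sigma> v"
  shows "chips \<sigma> t v \<le> max (chips \<sigma> 0 v) (2 * int (deg G v))"
proof (induction t)
  case (Suc t)
  have step: "chips \<sigma> (Suc t) v = chips \<sigma> t v + (\<Sum>w\<in>nbrs G v. int (fires \<sigma> t w))
      - int (fires \<sigma> t v) * int (deg G v)"
    using assms(2,3) by (simp add: chip_firing_game_def)
  have le: "(\<Sum>w\<in>nbrs G v. int (fires \<sigma> t w)) \<le> int (deg G v)"
    by (rule nbr_fires_le_deg[OF assms(1,2)])
  show ?case
  proof (cases "chips \<sigma> t v \<ge> int (deg G v)")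
    case True
    then have "fires \<sigma> t v = 1"
      using assms(4) by (simp add: ordinary_at_def)
    with step le Suc show ?thesis by simp
  next
    case False
    with assms(4) have "fires \<sigma> t v = 0"
      by (auto simp: ordinary_at_def)
    with step le False show ?thesis by simp
  qed
qed simp

text \<open>Bounded chip counts leave finitely many positions, so one recurs; a position determines
  all firings and hence its successor.\<close>

lemma ordinary_game_eventually_periodic:
  assumes G: "connected_graph G" and game: "ordinary_game G \<sigma>"
  obtains i p where "p > 0" "\<And>t v. t \<ge> i \<Longrightarrow> v \<in> pverts G \<Longrightarrow> fires \<sigma> (t + p) v = fires \<sigma> t v"
proof -
  let ?V = "pverts G"
  \<comment> \<open>Restriction discards the arbitrary values off the graph, which could keep
    positions from recurring.\<close>
  define state where "state t = restrict (chips \<sigma> t) ?V" for t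
  define X where "X = (\<Pi>\<^sub>E v\<in>?V. {0..max (chips \<sigma> 0 v) (2 * int (deg G v))})"
  have firing: "chip_firing_game G \<sigma>" and ord: "\<And>v. v \<in> ?V \<Longrightarrow> ordinary_at G \<sigma> v"
    using game by (auto simp: ordinary_game_def)
  have "finite ?V"
    using G by (simp add: connected_graph_iff)
  then have "finite X"
    unfolding X_def by (intro finite_PiE) auto
  moreover have "range state \<subseteq> X"
  proof
    fix x assume "x \<in> range state"
    then obtain t where x: "x = state t" by blast
    have "chips \<sigma> t v \<in> {0..max (chips \<sigma> 0 v) (2 * int (deg G v))}" if "v \<in> ?V" for v
      using ordinary_at_chips_le[OF G firing that ord[OF that], of t] ord[OF that]
      by (simp add: ordinary_at_def)
    then show "x \<in> X"
      by (simp add: x state_def X_def restrict_PiE_iff)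
  qed
  ultimately have "finite (range state)"
    by (rule rev_finite_subset)
  then have "\<not> inj state"
    using finite_imageD[of state UNIV] infinite_UNIV_nat by auto
  then obtain i j where "i < j" and ij: "state i = state j"
    by (metis linorder_injI)
  have chips_eq: "chips \<sigma> s v = chips \<sigma> t v" if "state s = state t" "v \<in> ?V" for s t v
    using fun_cong[OF that(1), of v] that(2) by (simp add: state_def)
  have fires_eq: "fires \<sigma> s v = fires \<sigma> t v" if "state s = state t" "v \<in> ?V" for s t v
  proof -
    have "fires \<sigma> t v = (if chips \<sigma> t v \<ge> int (deg G v) then 1 else 0)" for t
      using ord[OF that(2)] by (auto simp: ordinary_at_def)
    then show ?thesis
      using chips_eq[OF that] by simp
  qed
  have step: "state (Suc s) = state (Suc t)" if eq: "state s = state t" for s t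
  proof -
    have "chips \<sigma> (Suc s) v = chips \<sigma> (Suc t) v" if v: "v \<in> ?V" for v
    proof -
      have "(\<Sum>w\<in>nbrs G v. int (fires \<sigma> s w)) = (\<Sum>w\<in>nbrs G v. int (fires \<sigma> t w))"
        using nbrs_subset_pverts[OF G] fires_eq[OF eq] by (intro sum.cong) auto
      then show ?thesis
        using firing v fires_eq[OF eq v] chips_eq[OF eq v] by (simp add: chip_firing_game_def)
    qed
    then show ?thesis
      unfolding state_def by (intro restrict_ext) auto
  qed
  \<comment> \<open>The coincidence at \<open>i\<close> and \<open>j\<close> propagates forward,
    making \<open>j - i\<close> a period from time \<open>i\<close> on.\<close>
  have shift: "state (i + s) = state (j + s)" for s
  proof (induction s)
    case (Suc s)
    then show ?case using step[of "i + s" "j + s"] by simp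
  qed (simp add: ij)
  have period: "state (t + (j - i)) = state t" if t: "t \<ge> i" for t
  proof -
    obtain s where "t = i + s"
      using le_Suc_ex[OF t] by blast
    then show ?thesis
      using shift[of s] \<open>i < j\<close> by (simp add: add.commute[of s])
  qed
  show ?thesis
  proof (rule that)
    show "j - i > 0"
      using \<open>i < j\<close> by simp
    show "fires \<sigma> (t + (j - i)) v = fires \<sigma> t v" if "t \<ge> i" "v \<in> ?V" for t v
      by (rule fires_eq[OF period]) fact+
  qed
qed

section \<open>Activity and discrepancy of possible sequences\<close>

text \<open>Dividing the bounded discrepancy by \<open>n\<close> makes it vanish, so the limit
  exists and \<open>lim\<close> has its intended meaning.\<close>

lemma activity_eqI:
  fixes f :: "nat \<Rightarrow> nat" and \<alpha> :: real
  assumes "\<And>n. \<bar>(\<Sum>t<n. real (f t)) - \<alpha> * n\<bar> \<le> C"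
  shows "activity f = \<alpha>"
proof -
  have "\<bar>(1 / real n) * (\<Sum>t<n. real (f t)) - \<alpha>\<bar> \<le> C / real n" if "n > 0" for n
  proof -
    have "(1 / real n) * (\<Sum>t<n. real (f t)) - \<alpha> = ((\<Sum>t<n. real (f t)) - \<alpha> * n) / real n"
      using that by (simp add: field_simps)
    then show ?thesis
      using assms[of n] that by (simp add: divide_right_mono)
  qed
  then have "\<bar>(1 / real n) * (\<Sum>t<n. real (f t)) - \<alpha>\<bar> \<le> \<bar>C / real n\<bar>" if "n > 0" for n
    using that by (meson abs_ge_self order_trans)
  then have "\<forall>\<^sub>F n in sequentially.
      norm ((1 / real n) * (\<Sum>t<n. real (f t)) - \<alpha>) \<le> norm (C / real n) * 1"
    unfolding real_norm_def mult_1_right by (rule eventually_mono[OF eventually_gt_at_top])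
  then have "(\<lambda>n. (1 / real n) * (\<Sum>t<n. real (f t)) - \<alpha>) \<longlonglongrightarrow> 0"
    by (rule tendsto_0_le[OF lim_const_over_n])
  then show ?thesis
    unfolding activity_def by (rule limI[OF LIM_zero_cancel])
qed

lemma eventually_periodic_bounded:
  fixes g :: "nat \<Rightarrow> real"
  assumes "p > 0" "\<And>t. t \<ge> i \<Longrightarrow> g (t + p) = g t"
  shows "\<exists>C. \<forall>t. \<bar>g t\<bar> \<le> C"
proof -
  \<comment> \<open>Any time beyond \<open>i + p\<close> can be lowered by \<open>p\<close> without
    dropping below \<open>i\<close>, so the initial segment attains every value.\<close>
  define C where "C = Max ((\<lambda>t. \<bar>g t\<bar>) ` {..i + p})"
  have "\<bar>g t\<bar> \<le> C" for t
  proof (induction t rule: less_induct)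
    case (less t)
    show ?case
    proof (cases "t \<le> i + p")
      case True
      then show ?thesis
        unfolding C_def by (intro Max_ge) auto
    next
      case False
      then have "g t = g (t - p)"
        using assms(2)[of "t - p"] by simp
      then show ?thesis
        using less[of "t - p"] False assms(1) by simp
    qed
  qed
  then show ?thesis by blast
qed

text \<open>After the preperiod every period adds the same amount to the partial sums. Subtracting
  the matching linear term therefore leaves an eventually periodic, hence bounded, sequence;
  boundedness then identifies the slope as the activity.\<close>

lemma possible_bounded_discrepancy:
  assumes "possible f"
  shows "\<exists>C. \<forall>n. \<bar>(\<Sum>t<n. real (f t)) - activity f * n\<bar> \<le> C"
proof -
  obtain A :: "nat pair_pre_digraph" and \<rho> u
    where A: "connected_graph A" "ordinary_game A \<rho>" and u: "u \<in> pverts A"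
      and f: "\<And>t. fires \<rho> t u = f t"
    using assms by (auto simp: possible_def)
  obtain i p where "p > 0" and "\<And>t v. t \<ge> i \<Longrightarrow> v \<in> pverts A \<Longrightarrow> fires \<rho> (t + p) v = fires \<rho> t v"
    using ordinary_game_eventually_periodic[OF A] by metis
  with u f have per: "f (t + p) = f t" if "t \<ge> i" for t
    using that by metis
  define S where "S n = (\<Sum>t<n. real (f t))" for n
  \<comment> \<open>The mean of \<open>f\<close> over the first full period after
    \<open>i\<close>.\<close>
  define \<alpha> where "\<alpha> = (S (i + p) - S i) / p"
  have S_add: "S (n + p) = S n + \<alpha> * p" if "n \<ge> i" for n
    using that
  proof (induction n rule: dec_induct)
    case base
    then show ?case using \<open>p > 0\<close> by (simp add: \<alpha>_def)
  next
    case (step n)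
    then show ?case using per[of n] by (simp add: S_def)
  qed
  have "S (n + p) - \<alpha> * real (n + p) = S n - \<alpha> * real n" if "n \<ge> i" for n
    unfolding S_add[OF that] by (simp add: distrib_left)
  then obtain C where C: "\<And>n. \<bar>S n - \<alpha> * n\<bar> \<le> C"
    using eventually_periodic_bounded[OF \<open>p > 0\<close>, of i "\<lambda>n. S n - \<alpha> * real n"] by blast
  then have "activity f = \<alpha>"
    unfolding S_def by (rule activity_eqI)
  then have "\<bar>(\<Sum>t<n. real (f t)) - activity f * n\<bar> \<le> C" for n
    using C[of n] by (simp add: S_def)
  then show ?thesis
    by (intro exI allI)
qed

section \<open>Maximum principle and bounded chip counts\<close>

text \<open>The argument maximising \<open>W t\<close> depends on \<open>t\<close>; sorting the times by a maximiser \<open>a\<close> makes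
  "within bounded distance of the maximum" a property of vertices, which then spreads along edges
  from \<open>a\<close> until it reaches \<open>M\<close>.\<close>

lemma subharmonic_bounded_above:
  fixes W :: "'t \<Rightarrow> 'a \<Rightarrow> real"
  assumes G: "connected_graph G" and M: "M \<noteq> {}" "M \<subseteq> pverts G"
    and bd: "\<And>m. m \<in> M \<Longrightarrow> \<exists>K. \<forall>t. W t m \<le> K"
    and lap: "\<And>v. v \<in> pverts G - M \<Longrightarrow> \<exists>B. \<forall>t. B \<le> (\<Sum>w\<in>nbrs G v. W t w - W t v)"
  shows "\<exists>K. \<forall>t. \<forall>v\<in>pverts G. W t v \<le> K"
proof -
  let ?V = "pverts G"
  have fin: "finite ?V" and ne: "?V \<noteq> {}"
    using G by (auto simp: connected_graph_iff)
  define T where "T a = {t. \<forall>w\<in>?V. W t w \<le> W t a}" for a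
  have "\<exists>K. \<forall>t\<in>T a. W t a \<le> K" if a: "a \<in> ?V" for a
  proof -
    define P where "P v \<longleftrightarrow> (\<exists>C. \<forall>t\<in>T a. W t a - W t v \<le> C)" for v
    have spread: "P w" if "P v" "v \<in> ?V - M" "(v, w) \<in> parcs G" for v w
    proof -
      obtain C where C: "\<And>t. t \<in> T a \<Longrightarrow> W t a - W t v \<le> C"
        using \<open>P v\<close> by (auto simp: P_def)
      obtain B where B: "\<And>t. B \<le> (\<Sum>w\<in>nbrs G v. W t w - W t v)"
        using lap \<open>v \<in> ?V - M\<close> by blast
      have "W t a - W t w \<le> deg G v * C - B" if t: "t \<in> T a" for t
      proof -
        \<comment> \<open>At a time in \<open>T a\<close> all summands are nonnegative, so a single
          neighbour is controlled by the whole sum.\<close>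
        have "W t a - W t w \<le> (\<Sum>w\<in>nbrs G v. W t a - W t w)"
          using finite_nbrs[OF G] nbrs_subset_pverts[OF G] t \<open>(v, w) \<in> parcs G\<close>
          by (intro member_le_sum) (auto simp: T_def nbrs_def)
        also have "\<dots> = deg G v * (W t a - W t v) - (\<Sum>w\<in>nbrs G v. W t w - W t v)"
          by (simp add: deg_def sum_subtractf algebra_simps)
        also have "\<dots> \<le> deg G v * C - B"
          using C[OF t] B[of t] by (intro diff_mono mult_left_mono) auto
        finally show ?thesis .
      qed
      then show ?thesis
        by (auto simp: P_def)
    qed
    obtain m where m: "m \<in> M" using M by blast
    have "(a, m) \<in> (parcs G)\<^sup>*"
      using G a m M by (auto simp: connected_graph_iff)
    \<comment> \<open>The second disjunct absorbs a path that meets \<open>M\<close> early: up to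
      that point its vertices lie outside \<open>M\<close>, where \<open>spread\<close>
      applies.\<close>
    then have "P m \<or> (\<exists>m\<in>M. P m)"
    proof induction
      case base
      show ?case by (auto simp: P_def)
    next
      case (step v w)
      then have "v \<in> ?V"
        using G by (auto simp: connected_graph_iff)
      with step spread show ?case by blast
    qed
    then obtain m where "m \<in> M" "P m"
      using m by blast
    then obtain C where "\<And>t. t \<in> T a \<Longrightarrow> W t a - W t m \<le> C"
      by (auto simp: P_def)
    moreover obtain K where "\<And>t. W t m \<le> K"
      using bd[OF \<open>m \<in> M\<close>] by blast
    ultimately have "W t a \<le> K + C" if "t \<in> T a" for t
      using that by (smt (verit))
    then show ?thesis by blast
  qed
  then obtain K where K: "\<And>a t. a \<in> ?V \<Longrightarrow> t \<in> T a \<Longrightarrow> W t a \<le> K a"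
    by metis
  \<comment> \<open>Each \<open>t\<close> lies in \<open>T a\<close> for some maximiser
    \<open>a\<close>, and there are only finitely many candidates for \<open>a\<close>.\<close>
  have "W t v \<le> Max (K ` ?V)" if v: "v \<in> ?V" for t v
  proof -
    have "Max (W t ` ?V) \<in> W t ` ?V"
      using fin ne by (intro Max_in) auto
    then obtain a where a: "a \<in> ?V" "Max (W t ` ?V) = W t a"
      by auto
    then have max: "W t w \<le> W t a" if "w \<in> ?V" for w
      using that fin by (metis Max_ge finite_imageI imageI)
    then have "W t a \<le> K a"
      using a by (intro K) (auto simp: T_def)
    also have "\<dots> \<le> Max (K ` ?V)"
      using a fin by (intro Max_ge) auto
    finally show ?thesis
      using max[OF v] by simp
  qed
  then show ?thesis by blast
qed

text \<open>This is the update rule summed over time. The constant \<open>c\<close> cancels in each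
  difference; it allows a common drift to be subtracted from all firing counts.\<close>

lemma chips_eq_cumulative:
  assumes G: "connected_graph G" and game: "chip_firing_game G \<sigma>" and v: "v \<in> pverts G"
  shows "real_of_int (chips \<sigma> n v) = chips \<sigma> 0 v +
    (\<Sum>w\<in>nbrs G v. ((\<Sum>t<n. real (fires \<sigma> t w)) - c) - ((\<Sum>t<n. real (fires \<sigma> t v)) - c))"
proof (induction n)
  case (Suc n)
  have "chips \<sigma> (Suc n) v = chips \<sigma> n v + (\<Sum>w\<in>nbrs G v. int (fires \<sigma> n w))
      - int (fires \<sigma> n v) * int (deg G v)"
    using game v by (simp add: chip_firing_game_def)
  then have "real_of_int (chips \<sigma> (Suc n) v) = real_of_int (chips \<sigma> n v)
      + (\<Sum>w\<in>nbrs G v. real (fires \<sigma> n w) - real (fires \<sigma> n v))"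
    by (simp add: sum_subtractf deg_def)
  also have "\<dots> = chips \<sigma> 0 v + (\<Sum>w\<in>nbrs G v. 
     ((\<Sum>t<Suc n. real (fires \<sigma> t w)) - c) - ((\<Sum>t<Suc n. real (fires \<sigma> t v)) - c))"
    by (simp add: Suc sum.distrib[symmetric] algebra_simps)
  finally show ?case .
qed simp

text \<open>Only the motors' discrepancies are controlled at first. The two-sided chip bounds at the
  other vertices let the maximum principle be applied to both \<open>W\<close> and its
  negative.\<close>

lemma motorized_chips_bounded:
  fixes \<alpha> :: real
  assumes G: "connected_graph G" and game: "motorized_game G M \<sigma>"
    and disc: "\<And>m. m \<in> M \<Longrightarrow> \<exists>C. \<forall>n. \<bar>(\<Sum>t<n. real (fires \<sigma> t m)) - \<alpha> * n\<bar> \<le> C"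
    and v: "v \<in> pverts G"
  shows "\<exists>B. \<forall>t. \<bar>chips \<sigma> t v\<bar> \<le> B"
proof -
  let ?V = "pverts G"
  have M: "M \<noteq> {}" "M \<subseteq> ?V" and firing: "chip_firing_game G \<sigma>"
    and ord: "\<And>v. v \<in> ?V - M \<Longrightarrow> ordinary_at G \<sigma> v"
    using game by (auto simp: motorized_game_def)
  \<comment> \<open>Using the same \<alpha> at every vertex keeps the Laplacian of the firing counts
    unchanged.\<close>
  define W where "W n v = (\<Sum>t<n. real (fires \<sigma> t v)) - \<alpha> * n" for n v
  have lap: "(\<Sum>w\<in>nbrs G v. W n w - W n v) = real_of_int (chips \<sigma> n v) - chips \<sigma> 0 v"
    if "v \<in> ?V" for n v
    using chips_eq_cumulative[OF G firing that, of n "\<alpha> * n"] by (simp add: W_def)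
  have lap_bd: "0 - real_of_int (chips \<sigma> 0 v) \<le> (\<Sum>w\<in>nbrs G v. W n w - W n v)"
    "(\<Sum>w\<in>nbrs G v. W n w - W n v) \<le>
        real_of_int (max (chips \<sigma> 0 v) (2 * int (deg G v))) - chips \<sigma> 0 v"
    if "v \<in> ?V - M" for n v
  proof -
    have v: "v \<in> ?V" "ordinary_at G \<sigma> v" using that ord by auto
    from v(2) have "0 \<le> real_of_int (chips \<sigma> n v)"
      by (simp add: ordinary_at_def)
    moreover have "real_of_int (chips \<sigma> n v) \<le> real_of_int (max (chips \<sigma> 0 v) (2 * int (deg G v)))"
      using ordinary_at_chips_le[OF G firing v, of n] by (simp only: of_int_le_iff)
    ultimately show "0 - real_of_int (chips \<sigma> 0 v) \<le> (\<Sum>w\<in>nbrs G v. W n w - W n v)"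
      "(\<Sum>w\<in>nbrs G v. W n w - W n v) \<le>
        real_of_int (max (chips \<sigma> 0 v) (2 * int (deg G v))) - chips \<sigma> 0 v"
      unfolding lap[OF v(1)] by linarith+
  qed
  have bd: "\<exists>C. \<forall>n. \<bar>W n m\<bar> \<le> C" if "m \<in> M" for m
    using disc[OF that] by (simp add: W_def)
  obtain K where K: "\<And>n w. w \<in> ?V \<Longrightarrow> W n w \<le> K"
  proof -
    have "\<exists>K. \<forall>n. \<forall>v\<in>?V. W n v \<le> K"
      using lap_bd(1) bd by (intro subharmonic_bounded_above[OF G M]) (meson abs_le_D1, blast)
    with that show thesis by blast
  qed
  \<comment> \<open>A lower bound for \<open>W\<close> is the maximum principle for
    \<open>- W\<close>; here the upper bound on the chips of non-motors enters.\<close>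
  obtain L where L: "\<And>n w. w \<in> ?V \<Longrightarrow> - W n w \<le> L"
  proof -
    have "\<exists>B. \<forall>n. B \<le> (\<Sum>w\<in>nbrs G v. - W n w - - W n v)" if "v \<in> ?V - M" for v
    proof -
      have "(\<Sum>w\<in>nbrs G v. - W n w - - W n v) = - (\<Sum>w\<in>nbrs G v. W n w - W n v)" for n
        by (simp add: sum_negf[symmetric])
      then show ?thesis
        using lap_bd(2)[OF that] by (metis neg_le_iff_le)
    qed
    moreover have "\<exists>K. \<forall>n. - W n m \<le> K" if "m \<in> M" for m
      using bd[OF that] by (meson abs_le_D2)
    ultimately have "\<exists>K. \<forall>n. \<forall>v\<in>?V. - W n v \<le> K"
      by (intro subharmonic_bounded_above[OF G M])
    with that show thesis by blast
  qed
  \<comment> \<open>All values of \<open>W\<close> lie between \<open>- L\<close> and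
    \<open>K\<close>, so each neighbour contributes at most \<open>K + L\<close> to the Laplacian.
    The ceiling keeps the bound an integer.\<close>
  have "\<bar>chips \<sigma> n v\<bar> \<le> \<lceil>\<bar>real_of_int (chips \<sigma> 0 v)\<bar> + deg G v * (K + L)\<rceil>" for n
  proof -
    have "\<bar>\<Sum>w\<in>nbrs G v. W n w - W n v\<bar> \<le> (\<Sum>w\<in>nbrs G v. K + L)"
    proof (rule order_trans[OF sum_abs sum_mono])
      fix w assume "w \<in> nbrs G v"
      then have "w \<in> ?V" using nbrs_subset_pverts[OF G] by blast
      then show "\<bar>W n w - W n v\<bar> \<le> K + L"
        using K[of w n] L[of w n] K[OF v, of n] L[OF v, of n] by linarith
    qed
    then have "\<bar>real_of_int (chips \<sigma> n v)\<bar> \<le> \<bar>real_of_int (chips \<sigma> 0 v)\<bar> + deg G v * (K + L)"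
      unfolding lap[OF v] deg_def by simp
    then show ?thesis by linarith
  qed
  then show ?thesis by blast
qed

section \<open>The graph with copies glued to the motors\<close>

text \<open>Each \<open>m \<in> M\<close> is identified with the vertex \<open>u m\<close> of \<open>k m\<close> copies of \<open>A m\<close>; the map \<open>e\<close> names the
  remaining vertices of the copies.\<close>

locale motor_attachment =
  fixes G :: "'a pair_pre_digraph" and M :: "'a set"
    and A :: "'a \<Rightarrow> 'b pair_pre_digraph" and u :: "'a \<Rightarrow> 'b" and k :: "'a \<Rightarrow> nat"
    and e :: "'a \<times> nat \<times> 'b \<Rightarrow> 'a"
  assumes G: "connected_graph G" and M: "M \<subseteq> pverts G"
    and A: "\<And>m. m \<in> M \<Longrightarrow> connected_graph (A m)"
    and u: "\<And>m. m \<in> M \<Longrightarrow> u m \<in> pverts (A m)"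
    and inj_e: "inj_on e (SIGMA m:M. {..<k m} \<times> (pverts (A m) - {u m}))"
    and e_fresh: "e ` (SIGMA m:M. {..<k m} \<times> (pverts (A m) - {u m})) \<inter> pverts G = {}"
begin

definition new :: "('a \<times> nat \<times> 'b) set" where
  "new = (SIGMA m:M. {..<k m} \<times> (pverts (A m) - {u m}))"

definition emb :: "'a \<Rightarrow> nat \<Rightarrow> 'b \<Rightarrow> 'a" where
  "emb m i x = (if x = u m then m else e (m, i, x))"

definition H :: "'a pair_pre_digraph" where
  "H = \<lparr>pverts = pverts G \<union> e ` new,
    parcs = parcs G \<union> (\<Union>m\<in>M. \<Union>i<k m. map_prod (emb m i) (emb m i) ` parcs (A m))\<rparr>"

lemma emb_u [simp]: "emb m i (u m) = m"
  by (simp add: emb_def)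

lemma arcs_A: "m \<in> M \<Longrightarrow> (x, y) \<in> parcs (A m) \<Longrightarrow>
    x \<in> pverts (A m) \<and> y \<in> pverts (A m) \<and> x \<noteq> y \<and> (y, x) \<in> parcs (A m)"
  using A[of m] by (auto simp: connected_graph_iff irrefl_def dest: symD)

lemma arcs_G: "(x, y) \<in> parcs G \<Longrightarrow>
    x \<in> pverts G \<and> y \<in> pverts G \<and> x \<noteq> y \<and> (y, x) \<in> parcs G"
  using G by (auto simp: connected_graph_iff irrefl_def dest: symD)

lemma emb_in_pverts_G_iff:
  assumes "m \<in> M" "i < k m" "x \<in> pverts (A m)"
  shows "emb m i x \<in> pverts G \<longleftrightarrow> x = u m"
  using assms M e_fresh by (fastforce simp: emb_def)

text \<open>Copies overlap only in a glued vertex. All copies at \<open>m\<close> share that vertex,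
  hence the alternative \<open>x = u m\<close> to equality of indices.\<close>

lemma emb_eq_iff:
  assumes "m \<in> M" "i < k m" "x \<in> pverts (A m)" "m' \<in> M" "i' < k m'" "x' \<in> pverts (A m')"
  shows "emb m i x = emb m' i' x' \<longleftrightarrow> m = m' \<and> x = x' \<and> (i = i' \<or> x = u m)"
proof (cases "x = u m \<or> x' = u m'")
  case True
  then show ?thesis
    using emb_in_pverts_G_iff[of m i x] emb_in_pverts_G_iff[of m' i' x'] assms M
    by (metis emb_u subsetD)
next
  case False
  then have "(m, i, x) \<in> new" "(m', i', x') \<in> new"
    using assms by (auto simp: new_def)
  then show ?thesis
    using False inj_on_eq_iff[OF inj_e[folded new_def]] by (auto simp: emb_def)
qed

lemma emb_in_pverts_H: "m \<in> M \<Longrightarrow> i < k m \<Longrightarrow> x \<in> pverts (A m) \<Longrightarrow> emb m i x \<in> pverts H"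
  using M by (auto simp: H_def emb_def new_def)

lemma inj_emb: "m \<in> M \<Longrightarrow> i < k m \<Longrightarrow> inj_on (emb m i) (pverts (A m))"
  by (auto simp: inj_on_def emb_eq_iff)

lemma nbrs_A: "m \<in> M \<Longrightarrow> nbrs (A m) x \<subseteq> pverts (A m) - {x}"
  using arcs_A by (fastforce simp: nbrs_def)

lemma pverts_H_cases:
  assumes "v \<in> pverts H"
  obtains (G) "v \<in> pverts G - M" | (motor) "v \<in> M"
  | (new) m i x where "m \<in> M" "i < k m" "x \<in> pverts (A m)" "x \<noteq> u m" "v = emb m i x"
  using assms by (auto simp: H_def new_def emb_def)

lemma parcs_H_cases:
  assumes "(v, w) \<in> parcs H"
  obtains (G) "(v, w) \<in> parcs G"
  | (A) m i x y where "m \<in> M" "i < k m" "(x, y) \<in> parcs (A m)" "v = emb m i x" "w = emb m i y"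
  using assms by (auto simp: H_def)

lemma parcs_H_emb: "m \<in> M \<Longrightarrow> i < k m \<Longrightarrow> (x, y) \<in> parcs (A m) \<Longrightarrow> (emb m i x, emb m i y) \<in> parcs H"
  by (force simp: H_def)

lemma parcs_G_subset_H: "parcs G \<subseteq> parcs H"
  by (simp add: H_def)

text \<open>The only end that a copy arc can have in \<open>pverts G\<close> is a motor, so no other
  vertex of \<open>G\<close> gains a neighbour.\<close>

lemma nbrs_H_G: "v \<in> pverts G - M \<Longrightarrow> nbrs H v = nbrs G v"
  using parcs_G_subset_H emb_in_pverts_G_iff arcs_A
  by (auto simp: nbrs_def elim!: parcs_H_cases)

lemma nbrs_H_motor:
  assumes m: "m \<in> M"
  shows "nbrs H m = nbrs G m \<union> (\<Union>i<k m. emb m i ` nbrs (A m) (u m))"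
proof (intro equalityI subsetI)
  fix w assume "w \<in> nbrs H m"
  then have "(m, w) \<in> parcs H" by (simp add: nbrs_def)
  then show "w \<in> nbrs G m \<union> (\<Union>i<k m. emb m i ` nbrs (A m) (u m))"
  proof (cases rule: parcs_H_cases)
    case G
    then show ?thesis by (simp add: nbrs_def)
  next
    case (A m' i x y)
    have "emb m' i x \<in> pverts G"
      using A(4) m M by auto
    then have x: "x = u m'"
      using emb_in_pverts_G_iff[of m' i x] arcs_A[OF A(1,3)] A(1,2) by blast
    then have "m' = m"
      using A(4) by simp
    with A(2,3,5) x show ?thesis by (auto simp: nbrs_def)
  qed
next
  fix w assume "w \<in> nbrs G m \<union> (\<Union>i<k m. emb m i ` nbrs (A m) (u m))"
  then show "w \<in> nbrs H m"
    using parcs_G_subset_H parcs_H_emb[OF m, where x = "u m"] by (auto simp: nbrs_def)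
qed

lemma nbrs_H_new:
  assumes m: "m \<in> M" "i < k m" "x \<in> pverts (A m)" "x \<noteq> u m"
  shows "nbrs H (emb m i x) = emb m i ` nbrs (A m) x"
proof (intro equalityI subsetI)
  fix w assume "w \<in> nbrs H (emb m i x)"
  then have "(emb m i x, w) \<in> parcs H" by (simp add: nbrs_def)
  then show "w \<in> emb m i ` nbrs (A m) x"
  proof (cases rule: parcs_H_cases)
    case G
    then show ?thesis
      using arcs_G emb_in_pverts_G_iff[of m i x] m by blast
  next
    case (A m' i' x' y)
    then have "x' \<in> pverts (A m')"
      using arcs_A[of m' x' y] by blast
    then have "m = m' \<and> x = x' \<and> i = i'"
      using emb_eq_iff[of m i x m' i' x'] A(1,2,4) m by blast
    with A(3,5) show ?thesis by (auto simp: nbrs_def)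
  qed
next
  fix w assume "w \<in> emb m i ` nbrs (A m) x"
  then show "w \<in> nbrs H (emb m i x)"
    using parcs_H_emb m by (auto simp: nbrs_def)
qed

text \<open>The neighbours of \<open>u m\<close> in the copies are new vertices, distinct for
  distinct copies, so the neighbourhood of \<open>m\<close> splits disjointly. With \<open>f\<close>
  constantly 1 this gives degrees; with firing indicators it gives the chips received.\<close>

lemma sum_nbrs_H_motor:
  fixes f :: "'a \<Rightarrow> 'c::comm_monoid_add"
  assumes m: "m \<in> M"
  shows "(\<Sum>w\<in>nbrs H m. f w) = (\<Sum>w\<in>nbrs G m. f w) + (\<Sum>i<k m. \<Sum>x\<in>nbrs (A m) (u m). f (emb m i x))"
proof -
  let ?N = "\<lambda>i. emb m i ` nbrs (A m) (u m)"
  have fin: "finite (?N i)" for i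
    using finite_nbrs[OF A[OF m]] by simp
  have "?N i \<inter> ?N j = {}" if "i < k m" "j < k m" "i \<noteq> j" for i j
    using that nbrs_A[OF m, of "u m"] emb_eq_iff[OF m _ _ m] by (fastforce simp: m)
  then have "(\<Sum>w\<in>(\<Union>i<k m. ?N i). f w) = (\<Sum>i<k m. \<Sum>w\<in>?N i. f w)"
    using fin by (intro sum.UNION_disjoint) auto
  also have "\<dots> = (\<Sum>i<k m. \<Sum>x\<in>nbrs (A m) (u m). f (emb m i x))"
  proof (intro sum.cong refl)
    fix i assume "i \<in> {..<k m}"
    then have "inj_on (emb m i) (nbrs (A m) (u m))"
      using inj_emb[OF m] nbrs_A[OF m] by (meson Diff_subset inj_on_subset lessThan_iff subset_trans)
    then show "(\<Sum>w\<in>?N i. f w) = (\<Sum>x\<in>nbrs (A m) (u m). f (emb m i x))"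
      by (simp add: sum.reindex)
  qed
  finally have eq: "(\<Sum>w\<in>(\<Union>i<k m. ?N i). f w) = \<dots>" .
  have "?N i \<inter> pverts G = {}" if "i < k m" for i
    using that nbrs_A[OF m, of "u m"] emb_in_pverts_G_iff[OF m] by fastforce
  then have "nbrs G m \<inter> (\<Union>i<k m. ?N i) = {}"
    using nbrs_subset_pverts[OF G, of m] by blast
  then show ?thesis
    unfolding nbrs_H_motor[OF m] using fin finite_nbrs[OF G]
    by (subst sum.union_disjoint) (auto simp: eq)
qed

lemma sum_nbrs_H_new:
  assumes m: "m \<in> M" "i < k m" "x \<in> pverts (A m)" "x \<noteq> u m"
  shows "(\<Sum>w\<in>nbrs H (emb m i x). f w) = (\<Sum>y\<in>nbrs (A m) x. f (emb m i y))"
proof -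
  have "inj_on (emb m i) (nbrs (A m) x)"
    using inj_emb[OF m(1,2)] nbrs_A[OF m(1), of x] inj_on_subset by blast
  then show ?thesis
    by (simp add: nbrs_H_new[OF m] sum.reindex)
qed

lemma deg_H_G: "v \<in> pverts G - M \<Longrightarrow> deg H v = deg G v"
  by (simp add: deg_def nbrs_H_G)

lemma deg_H_motor: "m \<in> M \<Longrightarrow> deg H m = deg G m + k m * deg (A m) (u m)"
  using sum_nbrs_H_motor[of m "\<lambda>_. 1 :: nat"] by (simp add: deg_def)

lemma deg_H_new:
  "m \<in> M \<Longrightarrow> i < k m \<Longrightarrow> x \<in> pverts (A m) \<Longrightarrow> x \<noteq> u m \<Longrightarrow> deg H (emb m i x) = deg (A m) x"
  using sum_nbrs_H_new[of m i x "\<lambda>_. 1 :: nat"] by (simp add: deg_def)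

lemma connected_H: "connected_graph H"
proof -
  have "finite new"
    unfolding new_def using G M A by (intro finite_SigmaI) (auto simp: connected_graph_iff intro: finite_subset)
  then have fin: "finite (pverts H)"
    using G by (simp add: H_def connected_graph_iff)
  have sym: "sym (parcs H)"
  proof (rule symI)
    fix v w assume "(v, w) \<in> parcs H"
    then show "(w, v) \<in> parcs H"
    proof (cases rule: parcs_H_cases)
      case G
      then show ?thesis using arcs_G parcs_G_subset_H by blast
    next
      case (A m i x y)
      then show ?thesis using arcs_A parcs_H_emb by simp
    qed
  qed
  have sub: "v \<in> pverts H \<and> w \<in> pverts H \<and> v \<noteq> w" if "(v, w) \<in> parcs H" for v w
    using that
  proof (cases rule: parcs_H_cases)
    case G
    then show ?thesis using arcs_G by (auto simp: H_def)
  next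
    case (A m i x y)
    then show ?thesis
      using arcs_A[of m x y] emb_in_pverts_H[of m i] emb_eq_iff[of m i x m i y] by auto
  qed
  \<comment> \<open>Inside its copy each new vertex has a path to the glued vertex; any two vertices
    are then joined through \<open>G\<close>.\<close>
  have to_G: "\<exists>g\<in>pverts G. (v, g) \<in> (parcs H)\<^sup>*" if "v \<in> pverts H" for v
    using that
  proof (cases rule: pverts_H_cases)
    case (new m i x)
    then have "(x, u m) \<in> (parcs (A m))\<^sup>*"
      using A[of m] u[of m] by (auto simp: connected_graph_iff)
    then have "(emb m i x, emb m i (u m)) \<in> (parcs H)\<^sup>*"
    proof induction
      case (step y z)
      then show ?case
        using parcs_H_emb[OF new(1,2)] by (meson rtrancl.rtrancl_into_rtrancl)
    qed simp
    then show ?thesis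
      using new M by auto
  qed (use M in auto)
  have "(v, w) \<in> (parcs H)\<^sup>*" if vw: "v \<in> pverts H" "w \<in> pverts H" for v w
  proof -
    obtain g h where g: "g \<in> pverts G" "(v, g) \<in> (parcs H)\<^sup>*"
      and h: "h \<in> pverts G" "(w, h) \<in> (parcs H)\<^sup>*"
      using to_G vw by blast
    have "(g, h) \<in> (parcs H)\<^sup>*"
      using G g(1) h(1) rtrancl_mono[OF parcs_G_subset_H] by (auto simp: connected_graph_iff)
    moreover have "(h, w) \<in> (parcs H)\<^sup>*"
      using h(2) sym sym_rtrancl by (metis symD)
    ultimately show ?thesis
      using g(2) by (meson rtrancl_trans)
  qed
  moreover have "pverts H \<noteq> {}"
    using G by (simp add: H_def connected_graph_iff)
  ultimately show ?thesis
    unfolding connected_graph_iff using fin sym sub by (auto simp: irrefl_def)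
qed

lemma subgraph_G_H: "subgraph (with_proj G) (with_proj H)"
proof -
  have "wf_digraph (with_proj G)" "wf_digraph (with_proj H)"
    using G connected_H by (auto simp: connected_graph_def pair_graph_def pair_digraph_def pair_fin_digraph_def wf_digraph_wp_iff)
  then show ?thesis
    by (auto simp: subgraph_def compatible_def H_def)
qed

text \<open>A copy arc with both ends in \<open>G\<close> would have \<open>u m\<close> at both
  ends, and \<open>A m\<close> has no loops.\<close>

lemma induced_H: "with_proj H \<restriction> pverts G = with_proj G"
proof -
  have "(v, w) \<in> parcs G" if vw: "(v, w) \<in> parcs H" "v \<in> pverts G" "w \<in> pverts G" for v w
    using vw(1)
  proof (cases rule: parcs_H_cases)
    case (A m i x y)
    then show ?thesis
      using arcs_A[of m x y] emb_in_pverts_G_iff[of m i] vw(2,3) by auto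
  qed
  moreover have "parcs G \<subseteq> pverts G \<times> pverts G"
    using G by (simp add: connected_graph_iff)
  ultimately have "{a \<in> parcs H. fst a \<in> pverts G \<and> snd a \<in> pverts G} = parcs G"
    using parcs_G_subset_H by auto
  then show ?thesis
    by (simp add: induce_subgraph_def with_proj_def)
qed

section \<open>The game on the glued graph\<close>

text \<open>All copies at \<open>m\<close> run the same game \<open>\<rho> m\<close> in step, so
  their shares of chips at \<open>m\<close> are equal. The shift \<open>c\<close> is constant in
  time and so respects the update rule. New vertices are decoded by inverting
  \<open>e\<close>.\<close>

definition glued_game :: "'a chip_game \<Rightarrow> ('a \<Rightarrow> 'b chip_game) \<Rightarrow> ('a \<Rightarrow> int) \<Rightarrow> 'a chip_game" where
  "glued_game \<sigma> \<rho> c = \<lparr>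
     chips = \<lambda>t v. if v \<in> M then chips \<sigma> t v + c v + int (k v) * chips (\<rho> v) t (u v)
       else if v \<in> pverts G then chips \<sigma> t v
       else case inv_into new e v of (m, i, x) \<Rightarrow> chips (\<rho> m) t x,
     fires = \<lambda>t v. if v \<in> pverts G then fires \<sigma> t v
       else case inv_into new e v of (m, i, x) \<Rightarrow> fires (\<rho> m) t x\<rparr>"

lemma glued_game_new:
  assumes m: "m \<in> M" "i < k m" "x \<in> pverts (A m)" "x \<noteq> u m"
  shows "chips (glued_game \<sigma> \<rho> c) t (emb m i x) = chips (\<rho> m) t x"
    and "fires (glued_game \<sigma> \<rho> c) t (emb m i x) = fires (\<rho> m) t x"
proof -
  have "(m, i, x) \<in> new"
    using m by (simp add: new_def)
  then have "inv_into new e (emb m i x) = (m, i, x)"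
    using m inj_e by (simp add: emb_def inv_into_f_f new_def)
  moreover have "emb m i x \<notin> pverts G"
    using emb_in_pverts_G_iff m by simp
  ultimately show "chips (glued_game \<sigma> \<rho> c) t (emb m i x) = chips (\<rho> m) t x"
    "fires (glued_game \<sigma> \<rho> c) t (emb m i x) = fires (\<rho> m) t x"
    using M by (auto simp: glued_game_def)
qed

text \<open>Outside the copies' share, the chips on \<open>m\<close> stay in a window of length
  \<open>k m\<close> starting at \<open>deg G m\<close>. The copies' share moves in multiples of
  \<open>k m\<close>, so the total reaches \<open>deg H m\<close> exactly when \<open>u m\<close>
  reaches its own threshold in \<open>A m\<close>.\<close>

lemma ordinary_glued_game:
  assumes \<sigma>: "motorized_game G M \<sigma>"
    and \<rho>: "\<And>m. m \<in> M \<Longrightarrow> ordinary_game (A m) (\<rho> m)"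
    and eq: "\<And>m t. m \<in> M \<Longrightarrow> fires (\<rho> m) t (u m) = fires \<sigma> t m"
    and lower: "\<And>m t. m \<in> M \<Longrightarrow> int (deg G m) \<le> chips \<sigma> t m + c m"
    and upper: "\<And>m t. m \<in> M \<Longrightarrow> chips \<sigma> t m + c m < int (deg G m) + int (k m)"
  shows "ordinary_game H (glued_game \<sigma> \<rho> c)"
proof -
  let ?g = "glued_game \<sigma> \<rho> c"
  have \<sigma>_firing: "chip_firing_game G \<sigma>"
    and \<sigma>_ord: "\<And>v. v \<in> pverts G - M \<Longrightarrow> ordinary_at G \<sigma> v"
    using \<sigma> by (auto simp: motorized_game_def)
  have \<rho>_firing: "\<And>m. m \<in> M \<Longrightarrow> chip_firing_game (A m) (\<rho> m)"
    and \<rho>_ord: "\<And>m x. m \<in> M \<Longrightarrow> x \<in> pverts (A m) \<Longrightarrow> ordinary_at (A m) (\<rho> m) x"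
    using \<rho> by (auto simp: ordinary_game_def)
  have fires_G [simp]: "fires ?g t v = fires \<sigma> t v" if "v \<in> pverts G" for t v
    using that by (simp add: glued_game_def)
  \<comment> \<open>At \<open>x = u m\<close> this is the hypothesis \<open>eq\<close>: each copy
    sees the motor fire just as \<open>\<rho> m\<close> prescribes.\<close>
  have fires_emb [simp]: "fires ?g t (emb m i x) = fires (\<rho> m) t x"
    if "m \<in> M" "i < k m" "x \<in> pverts (A m)" for t m i x
    using glued_game_new(2)[OF that] that M eq[of m t] by (cases "x = u m") auto
  have sum_G: "(\<Sum>w\<in>nbrs G v. int (fires ?g t w)) = (\<Sum>w\<in>nbrs G v. int (fires \<sigma> t w))" for t v
    using nbrs_subset_pverts[OF G, of v] by (intro sum.cong) auto
  have sum_A: "(\<Sum>y\<in>nbrs (A m) x. int (fires ?g t (emb m i y))) = (\<Sum>y\<in>nbrs (A m) x. int (fires (\<rho> m) t y))"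
    if "m \<in> M" "i < k m" for t m i x
    using nbrs_A[of m x] that by (intro sum.cong) auto
  have "fires ?g t v \<in> {0, 1} \<and> chips ?g (Suc t) v =
      chips ?g t v + (\<Sum>w\<in>nbrs H v. int (fires ?g t w)) - int (fires ?g t v) * int (deg H v)"
    and "ordinary_at H ?g v" if "v \<in> pverts H" for t v
  proof -
    have "(\<forall>t. fires ?g t v \<in> {0, 1} \<and> chips ?g (Suc t) v =
        chips ?g t v + (\<Sum>w\<in>nbrs H v. int (fires ?g t w)) - int (fires ?g t v) * int (deg H v))
      \<and> ordinary_at H ?g v"
      using that
    proof (cases rule: pverts_H_cases)
      case G
      then have chips_v: "chips ?g t v = chips \<sigma> t v" for t
        by (simp add: glued_game_def)
      from G \<sigma>_firing \<sigma>_ord[OF G] show ?thesis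
        by (simp add: nbrs_H_G deg_H_G sum_G chips_v chip_firing_game_def ordinary_at_def)
    next
      case motor
      define d where "d = int (deg (A v) (u v))"
      have v: "v \<in> pverts G" using motor M by blast
      have chips_v: "chips ?g t v = chips \<sigma> t v + c v + int (k v) * chips (\<rho> v) t (u v)" for t
        using motor by (simp add: glued_game_def)
      have deg_v: "int (deg H v) = int (deg G v) + int (k v) * d"
        by (simp add: deg_H_motor[OF motor] d_def)
      have \<rho>_step: "chips (\<rho> v) (Suc t) (u v) = chips (\<rho> v) t (u v)
          + (\<Sum>y\<in>nbrs (A v) (u v). int (fires (\<rho> v) t y)) - int (fires \<sigma> t v) * d" for t
        using \<rho>_firing[OF motor] u[OF motor] eq[OF motor] by (simp add: chip_firing_game_def d_def)
      have \<sigma>_step: "fires \<sigma> t v \<in> {0, 1}" "chips \<sigma> (Suc t) v = chips \<sigma> t v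
          + (\<Sum>w\<in>nbrs G v. int (fires \<sigma> t w)) - int (fires \<sigma> t v) * int (deg G v)" for t
        using \<sigma>_firing v by (auto simp: chip_firing_game_def)
      have sum_v: "(\<Sum>w\<in>nbrs H v. int (fires ?g t w)) = (\<Sum>w\<in>nbrs G v. int (fires \<sigma> t w))
          + int (k v) * (\<Sum>y\<in>nbrs (A v) (u v). int (fires (\<rho> v) t y))" for t
        using motor by (simp add: sum_nbrs_H_motor sum_G sum_A)
      have "chips ?g (Suc t) v =
          chips ?g t v + (\<Sum>w\<in>nbrs H v. int (fires ?g t w)) - int (fires ?g t v) * int (deg H v)" for t
        unfolding chips_v sum_v deg_v fires_G[OF v] \<rho>_step \<sigma>_step(2) by (simp add: algebra_simps)
      moreover have "ordinary_at H ?g v"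
        unfolding ordinary_at_def
      proof (intro allI conjI impI)
        fix t
        let ?r = "chips (\<rho> v) t (u v)"
        have r: "0 \<le> ?r" "d \<le> ?r \<Longrightarrow> fires \<sigma> t v = 1" "?r \<le> d - 1 \<Longrightarrow> fires \<sigma> t v = 0"
          using \<rho>_ord[OF motor u[OF motor]] eq[OF motor] by (auto simp: ordinary_at_def d_def)
        show "0 \<le> chips ?g t v"
          using lower[OF motor, of t] r(1) by (simp add: chips_v)
        have big: "int (k v) * d \<le> int (k v) * ?r" if "d \<le> ?r"
          using that by (rule mult_left_mono) simp
        \<comment> \<open>Being one chip short at \<open>u v\<close> costs \<open>k v\<close> chips
          in total, more than the part from \<open>G\<close> can make up by
          \<open>upper\<close>.\<close>
        have small: "int (k v) * ?r \<le> int (k v) * (d - 1)" if "?r \<le> d - 1"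
          using that by (rule mult_left_mono) simp
        show "fires ?g t v = 1" if "int (deg H v) \<le> chips ?g t v"
        proof -
          have "d \<le> ?r"
          proof (rule ccontr)
            assume "\<not> d \<le> ?r"
            then have "int (k v) * ?r \<le> int (k v) * d - int (k v)"
              using small by (simp add: right_diff_distrib)
            with that upper[OF motor, of t] show False
              by (simp add: chips_v deg_v)
          qed
          then show ?thesis using r(2) v by simp
        qed
        show "fires ?g t v = 0" if "chips ?g t v \<le> int (deg H v) - 1"
        proof -
          have "?r \<le> d - 1"
          proof (rule ccontr)
            assume "\<not> ?r \<le> d - 1"
            then have "int (k v) * d \<le> int (k v) * ?r"
              using big by simp
            with that lower[OF motor, of t] show False
              by (simp add: chips_v deg_v)
          qed
          then show ?thesis using r(3) v by simp
        qed
      qed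
      ultimately show ?thesis
        using \<sigma>_step(1) v by simp
    next
      case (new m i x)
      note new' = new(1-4)
      from new \<rho>_firing[OF new(1)] \<rho>_ord[OF new(1,3)] show ?thesis
        by (simp add: glued_game_new[OF new'] deg_H_new[OF new'] sum_nbrs_H_new[OF new'] sum_A
            chip_firing_game_def ordinary_at_def)
    qed
    then show "fires ?g t v \<in> {0, 1} \<and> chips ?g (Suc t) v =
      chips ?g t v + (\<Sum>w\<in>nbrs H v. int (fires ?g t w)) - int (fires ?g t v) * int (deg H v)"
      "ordinary_at H ?g v" by blast+
  qed
  then show ?thesis
    by (simp add: ordinary_game_def chip_firing_game_def)
qed

end

section \<open>Fresh vertices and choice of parameters\<close>

text \<open>An infinite vertex type has room for the new vertices, so \<open>H\<close> can live on
  the type of \<open>G\<close>.\<close>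

lemma ex_inj_on_avoiding:
  fixes S :: "'a::infinite set"
  assumes "finite X" "finite S"
  shows "\<exists>e :: 'b \<Rightarrow> 'a. inj_on e X \<and> e ` X \<inter> S = {}"
proof -
  have "infinite (- S)"
    using assms(2) infinite_UNIV by (simp add: Compl_eq_Diff_UNIV)
  then obtain T where T: "finite T" "card T = card X" "T \<subseteq> - S"
    using infinite_arbitrarily_large by blast
  then obtain e where "bij_betw e X T"
    using finite_same_card_bij[OF assms(1)] by metis
  then show ?thesis
    using T(3) by (intro exI[of _ e]) (auto simp: bij_betw_def)
qed

theorem theorem4p1:
  fixes G :: "'a::infinite pair_pre_digraph"
    and M :: "'a set"
    and \<sigma> :: "'a chip_game"
  assumes "connected_graph G"
    and "motorized_game G M \<sigma>"
    and "\<And>m. m \<in> M \<Longrightarrow> possible (\<lambda>t. fires \<sigma> t m)"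
    and "\<And>m m'. m \<in> M \<Longrightarrow> m' \<in> M \<Longrightarrow>
           activity (\<lambda>t. fires \<sigma> t m) = activity (\<lambda>t. fires \<sigma> t m')"
  shows "\<exists>(H :: 'a pair_pre_digraph) \<sigma>'.
           connected_graph H \<and> subgraph (with_proj G) (with_proj H) \<and> ordinary_game H \<sigma>' \<and>
           (\<forall>t. \<forall>u\<in>pverts G. fires \<sigma>' t u = fires \<sigma> t u) \<and>
           (\<forall>v\<in>pverts G - M. deg H v = deg G v) \<and>
           with_proj H \<restriction> pverts G = with_proj G"
proof -
  have M: "M \<noteq> {}" "M \<subseteq> pverts G"
    using assms(2) by (auto simp: motorized_game_def)
  then obtain m0 where m0: "m0 \<in> M" by blast
  \<comment> \<open>Equal activities allow the activity of the single motor \<open>m0\<close> to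
    serve as the drift for all motors.\<close>
  have "\<exists>C. \<forall>n. \<bar>(\<Sum>t<n. real (fires \<sigma> t m)) - activity (\<lambda>t. fires \<sigma> t m0) * n\<bar> \<le> C"
    if "m \<in> M" for m
    unfolding assms(4)[OF m0 that] by (rule possible_bounded_discrepancy[OF assms(3)[OF that]])
  from motorized_chips_bounded[OF assms(1,2) this]
  obtain B where B: "\<And>m t. m \<in> M \<Longrightarrow> \<bar>chips \<sigma> t m\<bar> \<le> B m"
    using M(2) by (metis subsetD)
  obtain A \<rho> u where A: "\<And>m. m \<in> M \<Longrightarrow> connected_graph (A m :: nat pair_pre_digraph)"
    and \<rho>: "\<And>m. m \<in> M \<Longrightarrow> ordinary_game (A m) (\<rho> m)"
    and u: "\<And>m. m \<in> M \<Longrightarrow> u m \<in> pverts (A m)"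
    and eq: "\<And>m t. m \<in> M \<Longrightarrow> fires (\<rho> m) t (u m) = fires \<sigma> t m"
    using assms(3) unfolding possible_def by metis
  \<comment> \<open>The shift by \<open>c m\<close> moves chip counts from the range
    \<open>- B m\<close> to \<open>B m\<close> into the range \<open>deg G m\<close> to
    \<open>deg G m + 2 * B m\<close>; \<open>k m\<close> exceeds the width of this range by one, as
    the strict upper bound demands.\<close>
  define k where "k m = nat (2 * B m + 1)" for m
  define c where "c m = int (deg G m) + B m" for m
  define X where "X = (SIGMA m:M. {..<k m} \<times> (pverts (A m) - {u m}))"
  have "finite X"
    unfolding X_def using assms(1) M A
    by (intro finite_SigmaI) (auto simp: connected_graph_iff intro: finite_subset)
  then obtain e where e: "inj_on e X" "e ` X \<inter> pverts G = {}"
    using ex_inj_on_avoiding[of X "pverts G"] assms(1) by (auto simp: connected_graph_iff)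
  interpret motor_attachment G M A u k e
    by unfold_locales (use assms(1) M A u e in \<open>auto simp: X_def\<close>)
  have "ordinary_game H (glued_game \<sigma> \<rho> c)"
  proof (rule ordinary_glued_game[OF assms(2) \<rho> eq])
    fix m t assume "m \<in> M"
    then have "\<bar>chips \<sigma> t m\<bar> \<le> B m" by (rule B)
    then show "int (deg G m) \<le> chips \<sigma> t m + c m"
      "chips \<sigma> t m + c m < int (deg G m) + int (k m)"
      by (auto simp: c_def k_def)
  qed
  moreover have "fires (glued_game \<sigma> \<rho> c) t v = fires \<sigma> t v" if "v \<in> pverts G" for t v
    using that by (simp add: glued_game_def)
  ultimately show ?thesis
    using connected_H subgraph_G_H deg_H_G induced_H
    by (intro exI[of _ H] exI[of _ "glued_game \<sigma> \<rho> c"]) blast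
qed

end
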